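(* Let $n$ be a positive odd integer. Then the function $f : GL_n(\mathbb{R}) \to GL_n(\mathbb{R})$ defined by \[ f(A) = \begin{cases} -A & \text{if } A \in GL_n^+(\mathbb{R}), \\ -A^{-1} & \text{if } A \in GL_n^-(\mathbb{R}) \end{cases} \] is continuous and inverse ambiguous. Furthermore, this function restricts to a continuous inverse ambiguous function from the orthogonal group $O(n)$ to $O(n)$.
   Context: For a group $G$, a function $f : G \to G$ is called inverse ambiguous if it is bijective and its inverse function satisfies $f^{-1}(x) = (f(x))^{-1}$ for all $x \in G$, where the right-hand side is the group inverse of $f(x)$. Equivalently, $f(f(x)) = x^{-1}$ for all $x \in G$. $GL_n(\mathbb{R})$ is the multiplicative group of invertible real $n \times n$ matrices with its usual topology; $GL_n^+(\mathbb{R})$ (resp. $GL_n^-(\mathbb{R})$) is the subset of matrices with positive (resp. negative) determinant; $O(n) = \{A \in GL_n(\mathbb{R}) : AA^T = I_n\}$. *)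

theory Defs
  imports "HOL-Analysis.Analysis" "HOL-Algebra.Group"
begin

definition inverse_ambiguous :: "('a, 'b) monoid_scheme \<Rightarrow> ('a \<Rightarrow> 'a) \<Rightarrow> bool" where
  "inverse_ambiguous G f \<longleftrightarrow>
     group G \<and> bij_betw f (carrier G) (carrier G) \<and>
     (\<forall>x\<in>carrier G. inv_into (carrier G) f x = inv\<^bsub>G\<^esub> (f x))"

text \<open>The size \<open>n\<close> of the matrices is \<open>CARD('n)\<close>.\<close>

definition GL :: "(real^'n^'n) monoid" where
  "GL = \<lparr>carrier = {A. invertible A}, mult = (**), one = mat 1\<rparr>"

definition GL_pos :: "(real^'n^'n) set" where
  "GL_pos = {A \<in> carrier GL. det A > 0}"

definition GL_neg :: "(real^'n^'n) set" where
  "GL_neg = {A \<in> carrier GL. det A < 0}"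

definition orth_set :: "(real^'n^'n) set" where
  "orth_set = {A \<in> carrier GL. A ** transpose A = mat 1}"

definition orth_group :: "(real^'n^'n) monoid" where
  "orth_group = GL\<lparr>carrier := orth_set\<rparr>"

text \<open>\<open>GL_pos\<close> and \<open>GL_neg\<close> partition the carrier of \<open>GL\<close>; the value \<open>undefined\<close> is
  taken only at singular matrices.\<close>

definition amb_map :: "real^'n^'n \<Rightarrow> real^'n^'n" where
  "amb_map A =
     (if A \<in> GL_pos then - A
      else if A \<in> GL_neg then - matrix_inv A
      else undefined)"

lemma carrier_GL: "carrier GL = {A. invertible A}"
  by (simp add: GL_def)

lemma group_GL: "group (GL :: (real^'n^'n) monoid)"
proof (rule groupI)
  fix A :: "real^'n^'n" assume "A \<in> carrier GL"
  then show "\<exists>B\<in>carrier GL. B \<otimes>\<^bsub>GL\<^esub> A = \<one>\<^bsub>GL\<^esub>"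
    unfolding GL_def invertible_def by auto
qed (auto simp: GL_def invertible_mult matrix_mul_assoc invertible_def[of "mat 1"])

lemma inv_GL:
  assumes "invertible (A :: real^'n^'n)"
  shows "inv\<^bsub>GL\<^esub> A = matrix_inv A"
proof -
  interpret group "GL :: (real^'n^'n) monoid" by (rule group_GL)
  have "matrix_inv A ** A = mat 1" "A ** matrix_inv A = mat 1"
    using someI_ex[OF assms[unfolded invertible_def]] by (simp_all add: matrix_inv_def)
  then show ?thesis
    using assms by (intro inv_equality) (auto simp: GL_def invertible_def)
qed

lemma GL_pos_Un_GL_neg: "GL_pos \<union> GL_neg = carrier GL" "GL_pos \<inter> GL_neg = {}"
  by (auto simp: GL_pos_def GL_neg_def GL_def invertible_det_nz)

lemma orth_set_eq: "orth_set = {A. orthogonal_matrix A}"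
  unfolding orth_set_def orthogonal_matrix_def GL_def invertible_def
  using matrix_left_right_inverse by auto

lemma subgroup_orth_set: "subgroup orth_set (GL :: (real^'n^'n) monoid)"
proof -
  interpret group "GL :: (real^'n^'n) monoid" by (rule group_GL)
  show ?thesis
  proof (rule subgroupI)
    show "orth_set \<subseteq> carrier (GL :: (real^'n^'n) monoid)" by (auto simp: orth_set_def)
    show "(orth_set :: (real^'n^'n) set) \<noteq> {}"
      using orthogonal_matrix_id by (auto simp: orth_set_eq)
  next
    fix A :: "real^'n^'n" assume A: "A \<in> orth_set"
    then have inv: "invertible A" and o: "orthogonal_matrix A"
      by (auto simp: orth_set_def GL_def orthogonal_matrix_def matrix_left_right_inverse)
    have "inv\<^bsub>GL\<^esub> A = transpose A"
      using o inv by (intro inv_equality)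
        (auto simp: GL_def orthogonal_matrix_def transpose_invertible)
    then show "inv\<^bsub>GL\<^esub> A \<in> orth_set"
      using o by (simp add: orth_set_eq orthogonal_matrix_transpose)
  next
    fix A B :: "real^'n^'n" assume "A \<in> orth_set" "B \<in> orth_set"
    then show "A \<otimes>\<^bsub>GL\<^esub> B \<in> orth_set"
      by (simp add: orth_set_eq GL_def orthogonal_matrix_mul)
  qed
qed

lemma group_orth_group: "group (orth_group :: (real^'n^'n) monoid)"
  unfolding orth_group_def by (rule group.subgroup_imp_group[OF group_GL subgroup_orth_set])

end

theory Submission imports Defs begin

text \<open>The identity to prove is f(f(A)) = A^{-1}. For odd n, det(-A) = -det A, so f swaps the
  two signs of the determinant: if det A > 0, then A goes to -A and then to -(-A)^{-1} = A^{-1}; if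
  det A < 0, then A goes to -A^{-1}, of positive determinant, and then to A^{-1}
  (\<open>amb_map_amb_map\<close>). In any group, a self-map whose square is inversion is inverse
  ambiguous (\<open>inverse_ambiguousI\<close>).

  For continuity, the two sign classes are disjoint open sets covering the group, so each branch can
  be treated alone; the inverse is continuous by Cramer's rule
  (\<open>continuous_on_matrix_inv\<close>). Everything passes to the orthogonal group, which is
  closed under negation and inversion (\<open>amb_map_orth_set\<close>).\<close>

lemma continuous_on_det [continuous_intros]:
  fixes F :: "'a::topological_space \<Rightarrow> real^'n^'n"
  assumes "continuous_on S F"
  shows "continuous_on S (\<lambda>x. det (F x))"
  unfolding det_def by (intro continuous_intros assms)

lemma matrix_inv_mult:
  fixes A :: "real^'n^'n"
  assumes "invertible A"
  shows "A ** matrix_inv A = mat 1" "matrix_inv A ** A = mat 1"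
  using someI_ex[OF assms[unfolded invertible_def]] by (simp_all add: matrix_inv_def)

text \<open>A one-sided inverse of a square matrix is two-sided, so A can be cancelled.\<close>

lemma matrix_inv_eq:
  fixes A B :: "real^'n^'n"
  assumes "A ** B = mat 1"
  shows "matrix_inv A = B"
proof -
  have "invertible A"
    using assms matrix_left_right_inverse invertible_def by blast
  then have "matrix_inv A ** (A ** B) = B"
    by (simp add: matrix_mul_assoc matrix_inv_mult)
  then show ?thesis
    by (simp add: assms)
qed

lemma minus_matrix_mult_minus: "(- A) ** (- B) = A ** (B :: real^'n^'n)"
  by (simp add: matrix_matrix_mult_def)

lemma matrix_inv_minus:
  fixes A :: "real^'n^'n"
  assumes "invertible A"
  shows "matrix_inv (- A) = - matrix_inv A"
  by (intro matrix_inv_eq) (simp add: minus_matrix_mult_minus matrix_inv_mult assms)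

lemma matrix_inv_matrix_inv:
  fixes A :: "real^'n^'n"
  assumes "invertible A"
  shows "matrix_inv (matrix_inv A) = A"
  by (intro matrix_inv_eq matrix_inv_mult assms)

lemma det_matrix_inv:
  fixes A :: "real^'n^'n"
  assumes "invertible A"
  shows "det (matrix_inv A) = inverse (det A)"
  using arg_cong[OF matrix_inv_mult(1)[OF assms], of det] inverse_unique[of "det A"]
  by (simp add: det_mul)

lemma det_minus:
  fixes A :: "real^'n^'n"
  shows "det (- A) = (- 1) ^ CARD('n) * det A"
proof -
  \<comment> \<open>Negation is left multiplication by the matrix of the scaling by -1, whose
    determinant is (-1)^n.\<close>
  have "- A = matrix ((*\<^sub>R) (- 1)) ** A"
    by (simp add: vec_eq_iff matrix_matrix_mult_def matrix_def axis_def if_distrib if_distribR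
        sum.delta cong: if_cong)
  then show ?thesis
    by (simp only: det_mul det_matrix_scaleR)
qed

text \<open>Cramer's rule for A x = e_l, solved by column l of the inverse. It makes each entry of
  the inverse a rational function of the entries of A, hence continuous.\<close>

lemma matrix_inv_component:
  fixes A :: "real^'n^'n"
  assumes "invertible A"
  shows "matrix_inv A $ k $ l =
    det (\<chi> i j. if j = k then mat 1 $ i $ l else A $ i $ j) / det A"
proof -
  have "A *v column l (matrix_inv A) = column l (mat 1)"
    unfolding matrix_inv_mult(1)[OF assms, symmetric]
    by (simp add: vec_eq_iff column_def matrix_vector_mult_def matrix_matrix_mult_def)
  then have "column l (matrix_inv A) =
      (\<chi> k. det (\<chi> i j. if j = k then column l (mat 1) $ i else A $ i $ j) / det A)"
    using cramer[of A] assms by (simp add: invertible_det_nz)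
  then show ?thesis
    by (simp add: vec_eq_iff column_def cong: if_cong)
qed

lemma continuous_on_matrix_inv:
  "continuous_on {A :: real^'n^'n. invertible A} matrix_inv"
proof -
  have "continuous_on {A :: real^'n^'n. invertible A} (\<lambda>A. matrix_inv A $ k $ l)" for k l
  proof -
    have "continuous_on {A :: real^'n^'n. invertible A}
        (\<lambda>A. if j = k then mat 1 $ i $ l else A $ i $ j)" for i j
      by (cases "j = k") (auto intro!: continuous_intros)
    then have "continuous_on {A :: real^'n^'n. invertible A}
        (\<lambda>A. det (\<chi> i j. if j = k then mat 1 $ i $ l else A $ i $ j) / det A)"
      by (intro continuous_intros) (auto simp: invertible_det_nz)
    then show ?thesis
      by (rule continuous_on_eq) (simp add: matrix_inv_component)
  qed
  then have "continuous_on {A :: real^'n^'n. invertible A} (\<lambda>A. \<chi> k l. matrix_inv A $ k $ l)"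
    by (intro continuous_on_vec_lambda)
  then show ?thesis
    by simp
qed

text \<open>Computing f(f(f(x))) in two ways shows that f commutes with inversion; then x \<mapsto>
  f(x)^{-1} is a two-sided inverse of f.\<close>

lemma inverse_ambiguousI:
  assumes "group G"
    and closed: "\<And>x. x \<in> carrier G \<Longrightarrow> f x \<in> carrier G"
    and square: "\<And>x. x \<in> carrier G \<Longrightarrow> f (f x) = inv\<^bsub>G\<^esub> x"
  shows "inverse_ambiguous G f"
proof -
  interpret group G by fact
  have comm: "f (inv\<^bsub>G\<^esub> x) = inv\<^bsub>G\<^esub> (f x)" if "x \<in> carrier G" for x
    using square[OF that] square[OF closed[OF that]] by simp
  have right: "f (inv\<^bsub>G\<^esub> (f x)) = x" if "x \<in> carrier G" for x
    by (simp add: comm closed square that)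
  have bij: "bij_betw f (carrier G) (carrier G)"
    by (rule bij_betw_byWitness[where f' = "\<lambda>x. inv\<^bsub>G\<^esub> (f x)"])
      (auto simp: closed square right)
  moreover have "inv_into (carrier G) f x = inv\<^bsub>G\<^esub> (f x)" if "x \<in> carrier G" for x
    using bij right that closed by (intro inv_into_f_eq) (auto simp: bij_betw_def)
  ultimately show ?thesis
    by (simp add: inverse_ambiguous_def assms(1))
qed

lemma inv_orth_group:
  fixes A :: "real^'n^'n"
  assumes "A \<in> carrier orth_group"
  shows "inv\<^bsub>orth_group\<^esub> A = inv\<^bsub>GL\<^esub> A"
  using assms group.m_inv_consistent[OF group_GL subgroup_orth_set]
  by (simp add: orth_group_def)

lemma continuous_on_amb_map: "continuous_on (carrier GL) (amb_map :: real^'n^'n \<Rightarrow> _)"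
proof -
  \<comment> \<open>A nonzero determinant already forces invertibility, so both classes are open in
    the whole matrix space, as preimages of open half-lines under det.\<close>
  have GL_pos_eq: "GL_pos = {A :: real^'n^'n. det A > 0}"
    and GL_neg_eq: "GL_neg = {A :: real^'n^'n. det A < 0}"
    by (auto simp: GL_pos_def GL_neg_def GL_def invertible_det_nz)
  have "continuous_on GL_pos (amb_map :: real^'n^'n \<Rightarrow> _)"
    by (rule continuous_on_eq[of _ uminus]) (auto intro!: continuous_intros simp: amb_map_def)
  moreover have "continuous_on GL_neg (amb_map :: real^'n^'n \<Rightarrow> _)"
  proof (rule continuous_on_eq)
    show "continuous_on GL_neg (\<lambda>A :: real^'n^'n. - matrix_inv A)"
      by (intro continuous_on_minus continuous_on_subset[OF continuous_on_matrix_inv])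
        (auto simp: GL_neg_def GL_def)
  qed (use GL_pos_Un_GL_neg(2) in \<open>auto simp: amb_map_def\<close>)
  moreover have "open (GL_pos :: (real^'n^'n) set)" "open (GL_neg :: (real^'n^'n) set)"
    unfolding GL_pos_eq GL_neg_eq by (intro open_Collect_less continuous_intros)+
  ultimately show ?thesis
    unfolding GL_pos_Un_GL_neg(1)[symmetric] by (intro continuous_on_open_Un)
qed

lemma minus_orth_set:
  fixes A :: "real^'n^'n"
  assumes "A \<in> orth_set"
  shows "- A \<in> orth_set"
  using assms unfolding orth_set_eq orthogonal_matrix_def
  by (simp add: minus_matrix_mult_minus transpose_def matrix_matrix_mult_def)

lemma amb_map_orth_set:
  fixes A :: "real^'n^'n"
  assumes "A \<in> orth_set"
  shows "amb_map A \<in> orth_set"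
proof -
  have A: "A \<in> carrier GL" "invertible A"
    using assms by (auto simp: orth_set_def GL_def)
  then have "matrix_inv A \<in> orth_set"
    using subgroup.m_inv_closed[OF subgroup_orth_set assms] by (simp add: inv_GL)
  then show ?thesis
    using A GL_pos_Un_GL_neg(1) assms by (auto simp: amb_map_def minus_orth_set)
qed

text \<open>Oddness of n enters here: negation flips the sign of the determinant while inversion
  keeps it, so the second application of \<open>amb_map\<close> takes the other branch.\<close>

lemma
  fixes A :: "real^'n^'n"
  assumes n: "odd CARD('n)" and A: "A \<in> carrier GL"
  shows amb_map_GL: "amb_map A \<in> carrier GL"
    and amb_map_amb_map: "amb_map (amb_map A) = inv\<^bsub>GL\<^esub> A"
proof -
  have inv: "invertible A"
    using A by (simp add: carrier_GL)
  have mem: "B \<in> GL_pos \<longleftrightarrow> det B > 0" "B \<in> GL_neg \<longleftrightarrow> det B < 0"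
      "B \<in> carrier GL \<longleftrightarrow> det B \<noteq> 0" for B :: "real^'n^'n"
    by (auto simp: GL_pos_def GL_neg_def GL_def invertible_det_nz)
  have det: "det (- B) = - det B" for B :: "real^'n^'n"
    using n by (simp add: det_minus)
  note simps = amb_map_def mem det det_matrix_inv inv inv_GL matrix_inv_minus
    matrix_inv_matrix_inv
  consider "det A > 0" | "det A < 0"
    using A mem(3) by fastforce
  then show "amb_map A \<in> carrier GL" "amb_map (amb_map A) = inv\<^bsub>GL\<^esub> A"
    by (cases; simp add: simps)+
qed

theorem theorem5p1:
  fixes f :: "real^'n^'n \<Rightarrow> real^'n^'n"
  assumes "odd CARD('n)" and "f = amb_map"
  shows "continuous_map (top_of_set (carrier GL)) (top_of_set (carrier GL)) f
         \<and> inverse_ambiguous GL f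
         \<and> f ` carrier orth_group \<subseteq> carrier orth_group
         \<and> continuous_map (top_of_set (carrier orth_group)) (top_of_set (carrier orth_group))
             (restrict f (carrier orth_group))
         \<and> inverse_ambiguous orth_group (restrict f (carrier orth_group))"
proof (intro conjI)
  have carrier: "carrier (orth_group :: (real^'n^'n) monoid) = orth_set"
    by (simp add: orth_group_def)
  have sub: "orth_set \<subseteq> carrier (GL :: (real^'n^'n) monoid)"
    by (auto simp: orth_set_def)
  show "continuous_map (top_of_set (carrier GL)) (top_of_set (carrier GL)) f"
    using continuous_on_amb_map amb_map_GL assms by auto
  show "inverse_ambiguous GL f"
    using assms by (intro inverse_ambiguousI group_GL) (auto simp: amb_map_GL amb_map_amb_map)
  show "f ` carrier orth_group \<subseteq> carrier orth_group"
    using assms by (auto simp: carrier amb_map_orth_set)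
  have "continuous_on orth_set (restrict f orth_set)"
    using continuous_on_subset[OF continuous_on_amb_map sub] assms(2)
    by (auto elim: continuous_on_eq)
  then show "continuous_map (top_of_set (carrier orth_group)) (top_of_set (carrier orth_group))
      (restrict f (carrier orth_group))"
    using assms by (auto simp: carrier amb_map_orth_set)
  \<comment> \<open>The inner value stays in \<open>orth_set\<close>, so the outer
    \<open>restrict\<close> again evaluates to f, and the identity in \<open>GL\<close> carries over
    because the inverses in both groups agree.\<close>
  show "inverse_ambiguous orth_group (restrict f (carrier orth_group))"
    using assms sub
    by (intro inverse_ambiguousI group_orth_group)
      (auto simp: inv_orth_group carrier amb_map_orth_set amb_map_amb_map subset_iff)
qed

end
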